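(* Let $\mathcal H$ be a real Hilbert space, let $f:\mathcal H\to\mathbb R$ be a convex function whose gradient is Lipschitz continuous and such that $\operatorname{argmin}_{\mathcal H} f\ne\emptyset$, and let $\alpha>0$. Assume that $f$ is $\mathcal C^2$. The high resolution ODE, with temporal step size $\sqrt s$, of the algorithm (RAG$_\alpha$) gives the inertial dynamic with Hessian driven damping $$\ddot Y(t)+\frac{\alpha}{t}\dot Y(t)+\sqrt s\,\nabla^2 f(Y(t))\dot Y(t)+\left(1+\frac{\alpha\sqrt s}{2t}\right)\nabla f(Y(t))=0 .$$
   Context: The Ravine accelerated gradient algorithm (RAG$_\alpha$) with step size $s>0$ is $$w_k=y_k-s\nabla f(y_k),\qquad y_{k+1}=w_k+\left(1-\tfrac{\alpha}{k+1}\right)(w_k-w_{k-1}).$$ The "high resolution ODE with temporal step size $h=\sqrt s$" is understood in the following formal sense. One makes the ansatz $y_k=Y(t_k)$ for some smooth curve $t\mapsto Y(t)$ defined for $t\ge t_0>0$, where $t_k=(k+c)h$ with $c$ a real parameter to be adjusted, and performs a Taylor expansion in powers of $h$ (for $h$ close to zero) of the quantities entering the algorithm, the recursion being divided by $h^2=s$ and normalized so that $\ddot Y$ has coefficient $1$. Instead of letting $h\to0$, one keeps the terms of order $h=\sqrt s$ in the expansion and discards the terms of order $h^2=s$ and higher. *)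

theory Defs
  imports "HOL-Analysis.Analysis"
begin

definition RAG_w :: "('a::real_vector \<Rightarrow> 'a) \<Rightarrow> real \<Rightarrow> (nat \<Rightarrow> 'a) \<Rightarrow> nat \<Rightarrow> 'a" where
  "RAG_w gradf s y k = y k - s *\<^sub>R gradf (y k)"

text \<open>
  Left-hand side minus right-hand side of the recursion, so that \<open>y\<close> is generated by the Ravine
  algorithm with step size \<open>s\<close> iff \<open>RAG_residual gradf \<alpha> s y k = 0\<close> for all \<open>k \<ge> 1\<close>.
\<close>
definition RAG_residual ::
    "('a::real_vector \<Rightarrow> 'a) \<Rightarrow> real \<Rightarrow> real \<Rightarrow> (nat \<Rightarrow> 'a) \<Rightarrow> nat \<Rightarrow> 'a" where
  "RAG_residual gradf \<alpha> s y k =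
     y (k + 1) - (RAG_w gradf s y k
       + (1 - \<alpha> / (real k + 1)) *\<^sub>R (RAG_w gradf s y k - RAG_w gradf s y (k - 1)))"

text \<open>
  \<open>D 0\<close> is a curve of class \<open>C\<^sup>n\<close> on \<open>T\<close> and \<open>D i\<close> is its \<open>i\<close>-th derivative for \<open>i \<le> n\<close>
  (one-sided at boundary points of \<open>T\<close>); \<open>D i\<close> is unconstrained for \<open>i > n\<close>.
\<close>
definition Cn_curve_on ::
    "nat \<Rightarrow> real set \<Rightarrow> (nat \<Rightarrow> real \<Rightarrow> 'a::real_normed_vector) \<Rightarrow> bool" where
  "Cn_curve_on n T D \<longleftrightarrow>
     (\<forall>i<n. \<forall>t\<in>T. (D i has_vector_derivative D (Suc i) t) (at t within T)) \<and>
     continuous_on T (D n)"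

text \<open>
  \<open>high_resolution_ODE R c E\<close>: the equation \<open>E s t (Y t) (Y' t) (Y'' t) = 0\<close> is the high resolution
  ODE, with temporal step size \<open>h = sqrt s\<close>, of the recursion \<open>R s y k = 0\<close> (\<open>k \<ge> 1\<close>), for the
  ansatz \<open>y\<^sub>k = Y (t\<^sub>k)\<close>, \<open>t\<^sub>k = (k + c) h\<close>.

  The first conjunct says that \<open>E\<close> has the shape of a truncated, normalized expansion: \<open>Y''\<close> has
  coefficient \<open>1\<close>, and what remains has a term of order \<open>h\<^sup>0\<close> and one of order \<open>h\<^sup>1\<close>, neither of
  which involves \<open>s\<close> or \<open>Y''\<close>.

  The second conjunct says that the recursion, divided by \<open>h\<^sup>2 = s\<close> and normalized by a scalar
  \<open>\<mu> h t\<close> that does not depend on the curve, agrees with \<open>E\<close> up to terms of order higher than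
  \<open>h\<close>, for every curve \<open>Y\<close>.  The remainder is \<open>o(h)\<close>, uniformly for \<open>t\<^sub>k\<close> in compact
  intervals; it need not be \<open>O(h\<^sup>2)\<close> when the gradient in \<open>R\<close> is merely \<open>C\<^sup>1\<close>.  An \<open>o(h)\<close>
  remainder determines the coefficients of \<open>h\<^sup>0\<close> and \<open>h\<^sup>1\<close>.  Curves are required to be
  \<open>C\<^sup>3\<close> only, since solutions of the resulting ODE have in general no further smoothness in that case.
\<close>
definition high_resolution_ODE ::
    "(real \<Rightarrow> (nat \<Rightarrow> 'a) \<Rightarrow> nat \<Rightarrow> 'a::real_normed_vector) \<Rightarrow> real
      \<Rightarrow> (real \<Rightarrow> real \<Rightarrow> 'a \<Rightarrow> 'a \<Rightarrow> 'a \<Rightarrow> 'a) \<Rightarrow> bool" where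
  "high_resolution_ODE R c E \<longleftrightarrow>
     (\<exists>G0 G1. \<forall>s>0. \<forall>t>0. \<forall>x v a. E s t x v a = a + G0 t x v + sqrt s *\<^sub>R G1 t x v) \<and>
     (\<exists>\<mu>. \<forall>t0>0. \<forall>Y. Cn_curve_on 3 {t0..} Y \<longrightarrow>
        (\<forall>a b \<epsilon>. t0 < a \<and> \<epsilon> > 0 \<longrightarrow>
          (\<forall>\<^sub>F h in at_right 0. \<forall>k\<ge>1. let t = (real k + c) * h in
             t \<in> {a..b} \<longrightarrow>
             \<mu> h t \<noteq> 0 \<and>
             norm (\<mu> h t *\<^sub>R ((1 / h\<^sup>2) *\<^sub>R R (h\<^sup>2) (\<lambda>j. Y 0 ((real j + c) * h)) k)
                   - E (h\<^sup>2) t (Y 0 t) (Y 1 t) (Y 2 t)) \<le> \<epsilon> * h)))"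

end

theory Submission
  imports Defs
begin

text \<open>
  Write the recursion as a second difference of \<open>y\<close>, plus \<open>\<beta> = \<alpha> / (k + 1)\<close> times a backward
  difference of \<open>y\<close>, plus \<open>h\<^sup>2 \<nabla>f(y\<^sub>k)\<close>, plus \<open>(1 - \<beta>) h\<^sup>2\<close> times a backward difference of
  \<open>\<nabla>f(y)\<close>.  After division by \<open>h\<^sup>2\<close> the second difference gives \<open>Y''\<close>, the first difference
  gives \<open>(\<beta> / h) (Y' - (h / 2) Y'')\<close>, and the difference of gradients gives the Hessian damping
  \<open>h \<nabla>\<^sup>2f(Y) Y'\<close> to first order.  The first difference thus contributes a multiple of \<open>Y''\<close> of
  order \<open>h\<close>, and normalizing it away is what produces the factor \<open>1 + \<alpha> h / (2 t)\<close> in front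
  of the gradient.

  The shift \<open>c\<close> is determined by the requirement that the coefficient of \<open>Y'\<close> in the
  normalized equation be \<open>\<alpha> / t\<close>, with no correction of order \<open>h\<close>: this forces \<open>c = 1 - \<alpha> / 2\<close>.  With this choice
  and \<open>\<mu> = 1 + \<alpha> h / (2 t)\<close> one has \<open>k + 1 = t \<mu> / h\<close>, hence \<open>\<mu> \<beta> = \<alpha> h / t\<close> exactly.
  The coefficient \<open>\<beta>\<close> therefore never has to be expanded: the difference between the normalized
  recursion and the differential expression is an explicit combination of the Taylor remainders of
  \<open>Y\<close> (of orders three and two) and of \<open>\<nabla>f \<circ> Y\<close> (of order one), plus one term of order \<open>h\<^sup>2\<close>
  (\<open>RAG_residual_identity\<close>).

  It remains to see that the Taylor remainder of order \<open>n\<close> of a \<open>C\<^sup>n\<close> curve is \<open>o(h\<^sup>n)\<close>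
  uniformly on compact intervals (\<open>uniform_taylor\<close>).  This follows from uniform continuity of the
  \<open>n\<close>-th derivative.  It applies with \<open>n = 1\<close> to \<open>\<nabla>f \<circ> Y\<close>, which is only \<open>C\<^sup>1\<close>.
\<close>

section \<open>Taylor remainders uniform on compact intervals\<close>

text \<open>
  The Peano form of the remainder, with the oscillation of the highest derivative as the constant.
  The remainder of order \<open>n + 1\<close> has as its derivative the remainder of order \<open>n\<close> of the
  differentiated curve, so each induction step is one use of the mean value inequality.
\<close>
lemma taylor_remainder_bound:
  fixes D :: "nat \<Rightarrow> real \<Rightarrow> 'a::real_normed_vector"
  assumes "\<And>i x. i < n \<Longrightarrow> x \<in> S \<Longrightarrow> (D i has_vector_derivative D (Suc i) x) (at x within S)"
    and "convex S" "t \<in> S"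
    and "\<And>x. x \<in> S \<Longrightarrow> norm (D n x - D n t) \<le> \<eta>"
    and "x \<in> S"
  shows "norm (D 0 x - (\<Sum>i\<le>n. ((x - t) ^ i / fact i) *\<^sub>R D i t)) \<le> \<eta> * \<bar>x - t\<bar> ^ n"
  using assms
proof (induction n arbitrary: D x)
  case 0
  then show ?case by simp
next
  case (Suc n)
  define r where "r x = D 0 x - (\<Sum>i\<le>Suc n. ((x - t) ^ i / fact i) *\<^sub>R D i t)" for x
  define r' where "r' x = D 1 x - (\<Sum>i\<le>n. ((x - t) ^ i / fact i) *\<^sub>R D (Suc i) t)" for x
  have r': "norm (r' z) \<le> \<eta> * \<bar>z - t\<bar> ^ n" if "z \<in> S" for z
    using Suc.IH[of "\<lambda>i. D (Suc i)" z] Suc.prems that by (simp add: r'_def)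
  have "\<eta> \<ge> 0"
    using Suc.prems(4)[OF \<open>t \<in> S\<close>] by simp
  \<comment> \<open>Indexed this way, the sum differentiates term by term into the sum in \<open>r'\<close>.\<close>
  have r_alt: "r = (\<lambda>x. D 0 x - D 0 t - (\<Sum>i\<le>n. ((x - t) ^ Suc i / fact (Suc i)) *\<^sub>R D (Suc i) t))"
    by (simp add: r_def fun_eq_iff sum.atMost_Suc_shift del: sum.atMost_Suc fact_Suc)
  have pow: "((\<lambda>x. (x - t) ^ Suc i / fact (Suc i)) has_field_derivative (z - t) ^ i / fact i) (at z within S)"
    for i and z :: real
  proof -
    have "((\<lambda>x. (x - t) ^ Suc i / fact (Suc i)) has_field_derivative
             real (Suc i) * (z - t) ^ i / fact (Suc i)) (at z within S)"
      using DERIV_cdivide[OF DERIV_power_Suc[OF DERIV_diff[OF DERIV_ident DERIV_const]]]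
      by (simp del: fact_Suc power_Suc)
    also have "real (Suc i) * (z - t) ^ i / fact (Suc i) = (z - t) ^ i / fact i"
      by (simp del: of_nat_Suc)
    finally show ?thesis .
  qed
  have deriv: "(r has_vector_derivative r' z) (at z within S)" if "z \<in> S" for z
  proof -
    have "(r has_vector_derivative D 1 z - 0 -
        (\<Sum>i\<le>n. ((z - t) ^ Suc i / fact (Suc i)) *\<^sub>R 0 + ((z - t) ^ i / fact i) *\<^sub>R D (Suc i) t))
      (at z within S)"
      unfolding r_alt using Suc.prems(1)[of 0 z] that
      by (intro has_vector_derivative_diff has_vector_derivative_sum has_vector_derivative_scaleR
          has_vector_derivative_const pow) auto
    then show ?thesis by (simp add: r'_def)
  qed
  have seg: "closed_segment t x \<subseteq> S"
    using Suc.prems by (simp add: closed_segment_subset)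
  have "norm (r x - r t) \<le> (\<eta> * \<bar>x - t\<bar> ^ n) * norm (x - t)"
  proof (rule differentiable_bound[OF convex_closed_segment])
    fix z assume z: "z \<in> closed_segment t x"
    show "(r has_derivative (\<lambda>u. u *\<^sub>R r' z)) (at z within closed_segment t x)"
      using deriv z seg unfolding has_vector_derivative_def
      by (meson has_derivative_subset subsetD)
    \<comment> \<open>Bounding on the segment only replaces \<open>\<bar>z - t\<bar>\<close> by its largest value \<open>\<bar>x - t\<bar>\<close>; no
        factor \<open>1 / (n + 1)\<close> is gained, which an \<open>o(h\<^sup>n)\<close> estimate can afford.\<close>
    have "\<bar>z - t\<bar> \<le> \<bar>x - t\<bar>"
      using z by (auto simp: closed_segment_eq_real_ivl split: if_splits)
    then have "\<eta> * \<bar>z - t\<bar> ^ n \<le> \<eta> * \<bar>x - t\<bar> ^ n"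
      using \<open>\<eta> \<ge> 0\<close> by (intro mult_left_mono power_mono) auto
    then have "norm (r' z) \<le> \<eta> * \<bar>x - t\<bar> ^ n"
      using r'[of z] z seg by auto
    then show "onorm (\<lambda>u. u *\<^sub>R r' z) \<le> \<eta> * \<bar>x - t\<bar> ^ n"
      by (simp add: onorm_scaleR_left bounded_linear_ident onorm_id)
  qed auto
  moreover have "r t = 0"
    by (simp add: r_alt)
  ultimately show ?case
    by (simp add: r_def mult_ac)
qed

text \<open>
  The margin \<open>t0 < a\<close> leaves room for the backward step \<open>u = - h\<close>: for small \<open>h\<close> all points
  \<open>t + u\<close> stay in \<open>{t0..b + 1}\<close>, where the \<open>n\<close>-th derivative is uniformly continuous.
\<close>
lemma uniform_taylor:
  fixes D :: "nat \<Rightarrow> real \<Rightarrow> 'a::real_normed_vector"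
  assumes "Cn_curve_on n {t0..} D" "t0 < a" "\<eta> > 0"
  shows "\<forall>\<^sub>F h in at_right 0. \<forall>t\<in>{a..b}. \<forall>u. \<bar>u\<bar> = h \<longrightarrow>
           norm (D 0 (t + u) - (\<Sum>i\<le>n. (u ^ i / fact i) *\<^sub>R D i t)) \<le> \<eta> * h ^ n"
proof -
  have "uniformly_continuous_on {t0..b + 1} (D n)"
    using assms(1) by (intro compact_uniformly_continuous)
      (auto simp: Cn_curve_on_def intro: continuous_on_subset)
  then obtain \<delta> where "\<delta> > 0" and
    \<delta>: "\<And>x t. x \<in> {t0..b + 1} \<Longrightarrow> t \<in> {t0..b + 1} \<Longrightarrow> \<bar>x - t\<bar> < \<delta> \<Longrightarrow> norm (D n x - D n t) < \<eta>"
    using \<open>\<eta> > 0\<close> unfolding uniformly_continuous_on_def dist_norm real_norm_def by metis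
  have "\<forall>\<^sub>F h in at_right 0. h \<in> {0<..<min \<delta> (min 1 (a - t0))}"
    using \<open>\<delta> > 0\<close> \<open>t0 < a\<close> by (intro eventually_at_right_real) auto
  then show ?thesis
  proof (eventually_elim, safe)
    fix t u
    assume h: "\<bar>u\<bar> \<in> {0<..<min \<delta> (min 1 (a - t0))}" and t: "t \<in> {a..b}"
    let ?S = "{t - \<bar>u\<bar>..t + \<bar>u\<bar>}"
    have S: "?S \<subseteq> {t0..b + 1}"
      using h t by auto
    have "norm (D 0 (t + u) - (\<Sum>i\<le>n. ((t + u - t) ^ i / fact i) *\<^sub>R D i t)) \<le> \<eta> * \<bar>t + u - t\<bar> ^ n"
    proof (rule taylor_remainder_bound)
      fix i z assume "i < n" "z \<in> ?S"
      then show "(D i has_vector_derivative D (Suc i) z) (at z within ?S)"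
        using assms(1) S unfolding Cn_curve_on_def
        by (intro has_vector_derivative_within_subset[of _ _ z "{t0..}" ?S]) auto
    next
      fix z assume z: "z \<in> ?S"
      have "norm (D n z - D n t) < \<eta>"
        by (rule \<delta>) (use z S h t in auto)
      then show "norm (D n z - D n t) \<le> \<eta>" by simp
    qed auto
    then show "norm (D 0 (t + u) - (\<Sum>i\<le>n. (u ^ i / fact i) *\<^sub>R D i t)) \<le> \<eta> * \<bar>u\<bar> ^ n"
      by simp
  qed
qed

lemma Cn_curve_on_mono:
  assumes "Cn_curve_on n T D" "m \<le> n"
  shows "Cn_curve_on m T D"
proof (cases "m = n")
  case False
  with assms show ?thesis
    unfolding Cn_curve_on_def
    by (auto intro!: continuous_on_vector_derivative[of T "D m" "D (Suc m)"])
qed (use assms in simp)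

section \<open>The residual in terms of Taylor remainders\<close>

text \<open>
  Here \<open>x\<close>, \<open>v\<close>, \<open>a\<close>, \<open>b\<close> stand for the curve and its first three derivatives at \<open>t\<close>, and \<open>w\<close>
  for the derivative of the gradient along the curve.  The value at \<open>k - 1\<close> is expanded to third
  order for the second difference, where it is divided by \<open>h\<^sup>2\<close>, and to second order for the
  first difference, which carries the additional factor \<open>\<beta>\<close> of order \<open>h\<close>.  The right-hand side
  is \<open>o(h)\<close> as soon as \<open>p\<close> and \<open>m\<close> are \<open>o(h\<^sup>3)\<close>, \<open>q\<close> is \<open>o(h\<^sup>2)\<close> and \<open>r\<close> is \<open>o(h)\<close>.
\<close>
lemma RAG_residual_identity:
  fixes y :: "nat \<Rightarrow> 'a::real_vector" and t h \<alpha> :: real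
  assumes "h > 0" "t > 0" "\<alpha> > 0" "k \<ge> 1"
    and t: "t = (real k + (1 - \<alpha> / 2)) * h"
    and plus: "y (k + 1) = x + h *\<^sub>R v + (h\<^sup>2 / 2) *\<^sub>R a + (h ^ 3 / 6) *\<^sub>R b + p"
    and x: "y k = x"
    and minus: "y (k - 1) = x - h *\<^sub>R v + (h\<^sup>2 / 2) *\<^sub>R a - (h ^ 3 / 6) *\<^sub>R b + m"
    and minus': "y (k - 1) = x - h *\<^sub>R v + (h\<^sup>2 / 2) *\<^sub>R a + q"
    and grad: "gradf (y (k - 1)) = gradf x - h *\<^sub>R w + r"
  shows "(1 + \<alpha> * h / (2 * t)) *\<^sub>R ((1 / h\<^sup>2) *\<^sub>R RAG_residual gradf \<alpha> (h\<^sup>2) y k)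
       - (a + (\<alpha> / t) *\<^sub>R v + h *\<^sub>R w + (1 + \<alpha> * h / (2 * t)) *\<^sub>R gradf x)
     = ((1 + \<alpha> * h / (2 * t)) / h\<^sup>2) *\<^sub>R (p + m) - (\<alpha> / (t * h)) *\<^sub>R q
       - (1 - \<alpha> * h / (2 * t)) *\<^sub>R r - (\<alpha> * h\<^sup>2 / (2 * t)) *\<^sub>R w"
proof -
  define \<mu> where "\<mu> = 1 + \<alpha> * h / (2 * t)"
  define \<beta> where "\<beta> = \<alpha> / (real k + 1)"
  have "\<mu> > 0"
    using assms(1-3) unfolding \<mu>_def by (intro add_pos_nonneg) auto
  \<comment> \<open>This is where the shift \<open>1 - \<alpha> / 2\<close> enters: \<open>t \<mu> = t + \<alpha> h / 2 = (k + 1) h\<close>.\<close>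
  have "real k + 1 = t * \<mu> / h"
    using assms(1,2) by (simp add: \<mu>_def field_simps) (simp add: t field_simps)
  then have \<mu>\<beta>: "\<mu> * \<beta> = \<alpha> * h / t"
    using \<open>\<mu> > 0\<close> by (simp add: \<beta>_def)
  have res: "RAG_residual gradf \<alpha> (h\<^sup>2) y k =
      (y (k + 1) - 2 *\<^sub>R y k + y (k - 1)) + \<beta> *\<^sub>R (y k - y (k - 1))
      + h\<^sup>2 *\<^sub>R gradf x + ((1 - \<beta>) * h\<^sup>2) *\<^sub>R (gradf x - gradf (y (k - 1)))"
    unfolding RAG_residual_def RAG_w_def \<beta>_def[symmetric] x
    by (simp add: algebra_simps scaleR_2)
  have d2: "y (k + 1) - 2 *\<^sub>R y k + y (k - 1) = h\<^sup>2 *\<^sub>R a + (p + m)"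
    unfolding plus minus x by (simp add: algebra_simps scaleR_2 flip: scaleR_add_left)
  have d1: "y k - y (k - 1) = h *\<^sub>R v - (h\<^sup>2 / 2) *\<^sub>R a - q"
    unfolding minus' x by simp
  have dg: "gradf x - gradf (y (k - 1)) = h *\<^sub>R w - r"
    unfolding grad by simp
  have "\<mu> *\<^sub>R ((1 / h\<^sup>2) *\<^sub>R RAG_residual gradf \<alpha> (h\<^sup>2) y k) =
      \<mu> *\<^sub>R a + (\<mu> / h\<^sup>2) *\<^sub>R (p + m)
      + (\<mu> * \<beta> / h\<^sup>2) *\<^sub>R (h *\<^sub>R v - (h\<^sup>2 / 2) *\<^sub>R a - q)
      + \<mu> *\<^sub>R gradf x + (\<mu> - \<mu> * \<beta>) *\<^sub>R (h *\<^sub>R w - r)"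
    unfolding res d2 d1 dg using \<open>h > 0\<close> by (simp add: scaleR_add_right right_diff_distrib)
  also have "\<dots> = (\<mu> - \<mu> * \<beta> / 2) *\<^sub>R a + (\<mu> * \<beta> / h) *\<^sub>R v + ((\<mu> - \<mu> * \<beta>) * h) *\<^sub>R w + \<mu> *\<^sub>R gradf x
      + (\<mu> / h\<^sup>2) *\<^sub>R (p + m) - (\<mu> * \<beta> / h\<^sup>2) *\<^sub>R q - (\<mu> - \<mu> * \<beta>) *\<^sub>R r"
    using \<open>h > 0\<close> by (simp add: algebra_simps power2_eq_square)
  \<comment> \<open>The terms of order \<open>h\<close> in the coefficient of \<open>a\<close> cancel: this is the normalization.\<close>
  also have "\<mu> - \<mu> * \<beta> / 2 = 1"
    unfolding \<mu>\<beta> by (simp add: \<mu>_def)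
  also have "\<mu> * \<beta> / h = \<alpha> / t"
    unfolding \<mu>\<beta> using \<open>h > 0\<close> by simp
  also have "\<mu> * \<beta> / h\<^sup>2 = \<alpha> / (t * h)"
    unfolding \<mu>\<beta> using \<open>h > 0\<close> by (simp add: power2_eq_square)
  also have "\<mu> - \<mu> * \<beta> = 1 - \<alpha> * h / (2 * t)"
    unfolding \<mu>\<beta> by (simp add: \<mu>_def)
  also have "(1 - \<alpha> * h / (2 * t)) * h = h - \<alpha> * h\<^sup>2 / (2 * t)"
    by (simp add: algebra_simps power2_eq_square)
  finally show ?thesis
    by (simp add: \<mu>_def[symmetric] scaleR_diff_left)
qed

section \<open>The high resolution differential equation\<close>

theorem theorem4p1:
  fixes f :: "'a::{real_inner, complete_space} \<Rightarrow> real"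
    and gradf :: "'a \<Rightarrow> 'a"
    and hessf :: "'a \<Rightarrow> 'a \<Rightarrow>\<^sub>L 'a"
    and \<alpha> :: real
  assumes "convex_on UNIV f"
    and "\<And>x. GDERIV f x :> gradf x"
    and "\<exists>L. L-lipschitz_on UNIV gradf"
    and "{x. \<forall>y. f x \<le> f y} \<noteq> {}"
    and "\<And>x. (gradf has_derivative blinfun_apply (hessf x)) (at x)"
    and "continuous_on UNIV hessf"
    and "\<alpha> > 0"
  shows "\<exists>c. high_resolution_ODE (RAG_residual gradf \<alpha>) c
    (\<lambda>s t x v a. a + (\<alpha> / t) *\<^sub>R v + sqrt s *\<^sub>R blinfun_apply (hessf x) v
                   + (1 + \<alpha> * sqrt s / (2 * t)) *\<^sub>R gradf x)"
    (is "\<exists>c. high_resolution_ODE ?R c ?E")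
proof (rule exI[of _ "1 - \<alpha> / 2"], unfold high_resolution_ODE_def, intro conjI)
  show "\<exists>G0 G1. \<forall>s>0. \<forall>t>0. \<forall>x v a. ?E s t x v a = a + G0 t x v + sqrt s *\<^sub>R G1 t x v"
    by (rule exI[of _ "\<lambda>t x v. (\<alpha> / t) *\<^sub>R v + gradf x"],
        rule exI[of _ "\<lambda>t x v. blinfun_apply (hessf x) v + (\<alpha> / (2 * t)) *\<^sub>R gradf x"])
       (simp add: algebra_simps)
next
  let ?c = "1 - \<alpha> / 2"
  define \<mu> where "\<mu> h t = 1 + \<alpha> * h / (2 * t)" for h t :: real
  have "\<forall>\<^sub>F h in at_right 0. \<forall>k\<ge>1. let t = (real k + ?c) * h in t \<in> {a..b} \<longrightarrow> \<mu> h t \<noteq> 0 \<and>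
          norm (\<mu> h t *\<^sub>R ((1 / h\<^sup>2) *\<^sub>R ?R (h\<^sup>2) (\<lambda>j. Y 0 ((real j + ?c) * h)) k)
                - ?E (h\<^sup>2) t (Y 0 t) (Y 1 t) (Y 2 t)) \<le> \<epsilon> * h"
    if "t0 > 0" and Y: "Cn_curve_on 3 {t0..} Y" and "t0 < a" and "\<epsilon> > 0" for t0 Y a b \<epsilon>
  proof -
    define W where "W t = blinfun_apply (hessf (Y 0 t)) (Y 1 t)" for t
    \<comment> \<open>The gradient along the curve, followed by its derivative, as a \<open>C\<^sup>1\<close> curve.\<close>
    define G where "G i = (if i = 0 then \<lambda>t. gradf (Y 0 t) else W)" for i :: nat
    have "a > 0" using that by simp
    have cont_Y: "continuous_on {t0..} (Y i)" if "i \<le> 3" for i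
      using Cn_curve_on_mono[OF Y that] by (simp add: Cn_curve_on_def)
    have cont_W: "continuous_on {t0..} W"
      unfolding W_def
      by (intro continuous_intros cont_Y continuous_on_compose2[OF assms(6)]) auto
    have G: "Cn_curve_on 1 {t0..} G"
      unfolding Cn_curve_on_def
    proof (intro conjI allI ballI impI)
      fix i :: nat and t assume "i < 1" "t \<in> {t0..}"
      then have "(Y 0 has_derivative (\<lambda>u. u *\<^sub>R Y 1 t)) (at t within {t0..})"
        using Y by (simp add: Cn_curve_on_def has_vector_derivative_def)
      from has_derivative_compose[OF this assms(5)[of "Y 0 t"]]
      show "(G i has_vector_derivative G (Suc i) t) (at t within {t0..})"
        using \<open>i < 1\<close> by (simp add: G_def W_def has_vector_derivative_def blinfun.scaleR_right)
    qed (use cont_W in \<open>simp add: G_def\<close>)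
    have "compact (W ` {a..b})"
      using \<open>t0 < a\<close> by (intro compact_continuous_image continuous_on_subset[OF cont_W]) auto
    then obtain M where "M > 0" and M: "\<And>t. t \<in> {a..b} \<Longrightarrow> norm (W t) \<le> M"
      using compact_imp_bounded bounded_pos by (metis image_eqI)
    \<comment> \<open>For small \<open>h\<close> one has \<open>\<mu> \<le> 2\<close> and \<open>0 \<le> 1 - \<alpha> h / (2 t) \<le> 1\<close>, so remainders of relative
        size \<open>\<eta>\<close> contribute at most \<open>(4 + \<alpha> / a + 1) \<eta> h\<close>: four from the two remainders in the
        second difference.  This takes one half of \<open>\<epsilon> h\<close>; the term of order \<open>h\<^sup>2\<close> gets the other.\<close>
    define \<eta> where "\<eta> = \<epsilon> / (2 * (5 + \<alpha> / a))"
    have pos: "5 + \<alpha> / a > 0"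
      using \<open>\<alpha> > 0\<close> \<open>a > 0\<close> by (simp add: add_pos_pos)
    have "\<eta> > 0" and \<eta>: "(5 + \<alpha> / a) * \<eta> = \<epsilon> / 2"
      using \<open>\<epsilon> > 0\<close> pos unfolding \<eta>_def by (auto intro!: divide_pos_pos simp: divide_simps)
    \<comment> \<open>The first bound gives \<open>\<alpha> h / (2 t) \<le> 1\<close>, the second \<open>\<alpha> h\<^sup>2 M / (2 a) \<le> \<epsilon> h / 2\<close>.\<close>
    have small: "\<forall>\<^sub>F h in at_right 0. h \<in> {0<..<min (2 * a / \<alpha>) (\<epsilon> * a / (\<alpha> * M))}"
      using \<open>\<alpha> > 0\<close> \<open>a > 0\<close> \<open>\<epsilon> > 0\<close> \<open>M > 0\<close> by (intro eventually_at_right_real) auto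
    have Y2: "Cn_curve_on 2 {t0..} Y"
      by (rule Cn_curve_on_mono[OF Y]) simp
    note taylor = uniform_taylor[OF _ \<open>t0 < a\<close> \<open>\<eta> > 0\<close>, where b = b]
    show ?thesis
      using taylor[OF Y] taylor[OF Y2] taylor[OF G] small
    proof eventually_elim
      case (elim h)
      show ?case
        unfolding Let_def
      proof (intro allI impI)
        fix k :: nat
        let ?t = "(real k + ?c) * h"
        assume kt: "1 \<le> k" "?t \<in> {a..b}"
        define t where "t = (real k + ?c) * h"
        define y where "y j = Y 0 ((real j + ?c) * h)" for j
        define p where "p = Y 0 (t + h) - (\<Sum>i\<le>3. (h ^ i / fact i) *\<^sub>R Y i t)"
        define m where "m = Y 0 (t + - h) - (\<Sum>i\<le>3. ((- h) ^ i / fact i) *\<^sub>R Y i t)"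
        define q where "q = Y 0 (t + - h) - (\<Sum>i\<le>2. ((- h) ^ i / fact i) *\<^sub>R Y i t)"
        define r where "r = G 0 (t + - h) - (\<Sum>i\<le>1. ((- h) ^ i / fact i) *\<^sub>R G i t)"
        have "h > 0" and h: "h < 2 * a / \<alpha>" "h < \<epsilon> * a / (\<alpha> * M)"
          using elim(4) by auto
        have t: "t \<in> {a..b}" "t > 0"
          using kt \<open>a > 0\<close> by (auto simp: t_def)
        have p: "norm p \<le> \<eta> * h ^ 3" and m: "norm m \<le> \<eta> * h ^ 3"
          using elim(1)[rule_format, OF t(1), of h] elim(1)[rule_format, OF t(1), of "- h"] \<open>h > 0\<close>
          unfolding p_def m_def by auto
        have q: "norm q \<le> \<eta> * h\<^sup>2"
          using elim(2)[rule_format, OF t(1), of "- h"] \<open>h > 0\<close> unfolding q_def by auto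
        have r: "norm r \<le> \<eta> * h"
          using elim(3)[rule_format, OF t(1), of "- h"] \<open>h > 0\<close> unfolding r_def by auto
        have y0: "y k = Y 0 t"
          by (simp add: y_def t_def)
        have y_plus: "y (k + 1) = Y 0 (t + h)"
          by (simp add: y_def t_def algebra_simps)
        have y_minus: "y (k - 1) = Y 0 (t + - h)"
          using kt by (simp add: y_def t_def algebra_simps)
        let ?d = "\<alpha> * h / (2 * t)"
        let ?err = "(\<mu> h t / h\<^sup>2) *\<^sub>R (p + m) - (\<alpha> / (t * h)) *\<^sub>R q - (1 - ?d) *\<^sub>R r - (\<alpha> * h\<^sup>2 / (2 * t)) *\<^sub>R W t"
        have err: "\<mu> h t *\<^sub>R ((1 / h\<^sup>2) *\<^sub>R ?R (h\<^sup>2) y k) - ?E (h\<^sup>2) t (Y 0 t) (Y 1 t) (Y 2 t) = ?err"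
        proof -
          have "\<mu> h t *\<^sub>R ((1 / h\<^sup>2) *\<^sub>R ?R (h\<^sup>2) y k)
              - (Y 2 t + (\<alpha> / t) *\<^sub>R Y 1 t + h *\<^sub>R W t + \<mu> h t *\<^sub>R gradf (Y 0 t)) = ?err"
            unfolding \<mu>_def
          proof (rule RAG_residual_identity)
            show "y (k + 1) = Y 0 t + h *\<^sub>R Y 1 t + (h\<^sup>2 / 2) *\<^sub>R Y 2 t + (h ^ 3 / 6) *\<^sub>R Y 3 t + p"
              unfolding y_plus p_def by (simp add: eval_nat_numeral)
            show "y (k - 1) = Y 0 t - h *\<^sub>R Y 1 t + (h\<^sup>2 / 2) *\<^sub>R Y 2 t - (h ^ 3 / 6) *\<^sub>R Y 3 t + m"
              unfolding y_minus m_def by (simp add: eval_nat_numeral)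
            show "y (k - 1) = Y 0 t - h *\<^sub>R Y 1 t + (h\<^sup>2 / 2) *\<^sub>R Y 2 t + q"
              unfolding y_minus q_def by (simp add: eval_nat_numeral)
            show "gradf (y (k - 1)) = gradf (Y 0 t) - h *\<^sub>R W t + r"
              unfolding y_minus r_def by (simp add: G_def)
          qed (use kt t y0 \<open>h > 0\<close> \<open>\<alpha> > 0\<close> in \<open>auto simp: t_def\<close>)
          then show ?thesis
            using \<open>h > 0\<close> by (simp add: \<mu>_def W_def)
        qed
        have d: "0 \<le> ?d" "?d \<le> 1"
        proof -
          have "\<alpha> * h \<le> 2 * a"
            using h(1) \<open>\<alpha> > 0\<close> by (simp add: field_simps)
          then show "?d \<le> 1"
            using t by (simp add: divide_simps)
        qed (use \<open>h > 0\<close> \<open>\<alpha> > 0\<close> t in auto)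
        have "norm ((\<mu> h t / h\<^sup>2) *\<^sub>R (p + m)) \<le> 2 / h\<^sup>2 * (\<eta> * h ^ 3 + \<eta> * h ^ 3)"
          unfolding norm_scaleR
          using d p m \<open>\<eta> > 0\<close> \<open>h > 0\<close>
          by (intro mult_mono order_trans[OF norm_triangle_ineq] add_mono)
             (auto simp: \<mu>_def divide_right_mono)
        also have "\<dots> = 4 * \<eta> * h"
          using \<open>h > 0\<close> by (simp add: power2_eq_square power3_eq_cube)
        finally have 1: "norm ((\<mu> h t / h\<^sup>2) *\<^sub>R (p + m)) \<le> 4 * \<eta> * h" .
        have "norm ((\<alpha> / (t * h)) *\<^sub>R q) \<le> \<alpha> / (a * h) * (\<eta> * h\<^sup>2)"
          unfolding norm_scaleR
          using q t \<open>a > 0\<close> \<open>\<eta> > 0\<close> \<open>h > 0\<close> \<open>\<alpha> > 0\<close>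
          by (intro mult_mono) (auto intro!: divide_left_mono)
        also have "\<dots> = \<alpha> / a * \<eta> * h"
          using \<open>h > 0\<close> by (simp add: power2_eq_square)
        finally have 2: "norm ((\<alpha> / (t * h)) *\<^sub>R q) \<le> \<alpha> / a * \<eta> * h" .
        have "norm ((1 - ?d) *\<^sub>R r) \<le> 1 * (\<eta> * h)"
          unfolding norm_scaleR using d r by (intro mult_mono) auto
        then have 3: "norm ((1 - ?d) *\<^sub>R r) \<le> \<eta> * h" by simp
        have "norm ((\<alpha> * h\<^sup>2 / (2 * t)) *\<^sub>R W t) \<le> \<alpha> * h\<^sup>2 / (2 * a) * M"
          unfolding norm_scaleR
          using M[OF t(1)] t \<open>a > 0\<close> \<open>h > 0\<close> \<open>\<alpha> > 0\<close>
          by (intro mult_mono) (auto intro!: divide_left_mono)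
        also have "\<dots> \<le> \<epsilon> / 2 * h"
          using h(2) \<open>a > 0\<close> \<open>h > 0\<close> \<open>\<alpha> > 0\<close> \<open>M > 0\<close> by (simp add: field_simps power2_eq_square)
        finally have 4: "norm ((\<alpha> * h\<^sup>2 / (2 * t)) *\<^sub>R W t) \<le> \<epsilon> / 2 * h" .
        have "norm ?err \<le> 4 * \<eta> * h + \<alpha> / a * \<eta> * h + \<eta> * h + \<epsilon> / 2 * h"
          by (intro order_trans[OF norm_triangle_ineq4] add_mono 1 2 3 4)
        also have "\<dots> = ((5 + \<alpha> / a) * \<eta> + \<epsilon> / 2) * h"
          by (simp add: algebra_simps)
        also have "\<dots> = \<epsilon> * h"
          by (simp add: \<eta>)
        finally have "norm ?err \<le> \<epsilon> * h" .
        moreover have "\<mu> h t \<noteq> 0"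
          using d by (simp add: \<mu>_def)
        ultimately show "\<mu> h ?t \<noteq> 0 \<and> norm (\<mu> h ?t *\<^sub>R ((1 / h\<^sup>2) *\<^sub>R ?R (h\<^sup>2) (\<lambda>j. Y 0 ((real j + ?c) * h)) k)
                  - ?E (h\<^sup>2) ?t (Y 0 ?t) (Y 1 ?t) (Y 2 ?t)) \<le> \<epsilon> * h"
          unfolding t_def[symmetric] y_def[symmetric] err by simp
      qed
    qed
  qed
  then show "\<exists>\<mu>. \<forall>t0>0. \<forall>Y. Cn_curve_on 3 {t0..} Y \<longrightarrow>
        (\<forall>a b \<epsilon>. t0 < a \<and> \<epsilon> > 0 \<longrightarrow>
          (\<forall>\<^sub>F h in at_right 0. \<forall>k\<ge>1. let t = (real k + ?c) * h in
             t \<in> {a..b} \<longrightarrow>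
             \<mu> h t \<noteq> 0 \<and>
             norm (\<mu> h t *\<^sub>R ((1 / h\<^sup>2) *\<^sub>R ?R (h\<^sup>2) (\<lambda>j. Y 0 ((real j + ?c) * h)) k)
                   - ?E (h\<^sup>2) t (Y 0 t) (Y 1 t) (Y 2 t)) \<le> \<epsilon> * h))"
    by (intro exI[of _ \<mu>]) blast
qed

end
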